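(* Let $E,F$ be locally convex spaces, $U$ an open neighborhood of $0$ in $E$, and $f:U\to F$ a function. If $f(U)$ is a bounded subset of $F$, then $f$ is a finite function.
   Context: We work in a sufficiently saturated nonstandard extension; $A^*$ is the nonstandard extension of $A$, and the extension of a function is denoted by the same symbol. A locally convex space is a real Hausdorff topological vector space with a base of convex neighborhoods of $0$. $E_f=\{x\in E^* : p(x)$ is a finite hyperreal for all continuous seminorms $p$ on $E\}$, and similarly $F_f$. $f:U\to F$ is a finite function if $f(U^*\cap E_f)\subseteq F_f$. A subset $B$ of a topological vector space is bounded if for every neighborhood $O$ of $0$ there is $n\in\mathbb N$ with $B\subseteq nO$. *)

theory Defs
  imports "HOL-Analysis.Analysis"
begin

unbundle cardinal_syntax

section \<open>Locally convex spaces\<close>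

text \<open>
  The class assumption below spells out the constants \<open>convex\<close> and \<open>interior\<close>, which cannot be
  used in class specifications; lemma \<open>convex_nhds_base\<close> restates it in terms of them.
\<close>

class locally_convex_space = real_vector + topological_ab_group_add + t2_space +
  assumes tendsto_scaleR_Pair:
      "LIM z (nhds a \<times>\<^sub>F nhds x). fst z *\<^sub>R snd z :> nhds (a *\<^sub>R x)"
    and ex_convex_nhds:
      "open V \<Longrightarrow> 0 \<in> V \<Longrightarrow>
       \<exists>C W. (\<forall>x\<in>C. \<forall>y\<in>C. \<forall>u\<ge>0. \<forall>v\<ge>0. u + v = 1 \<longrightarrow> u *\<^sub>R x + v *\<^sub>R y \<in> C) \<and>
             open W \<and> 0 \<in> W \<and> W \<subseteq> C \<and> C \<subseteq> V"

lemma convex_nhds_base: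
  fixes V :: "'a::locally_convex_space set"
  assumes "0 \<in> interior V"
  shows "\<exists>C. convex C \<and> 0 \<in> interior C \<and> C \<subseteq> V"
proof -
  obtain C W where C: "\<forall>x\<in>C. \<forall>y\<in>C. \<forall>u\<ge>0. \<forall>v\<ge>0. u + v = 1 \<longrightarrow> u *\<^sub>R x + v *\<^sub>R y \<in> C"
    and W: "open W" "0 \<in> W" "W \<subseteq> C" "C \<subseteq> interior V"
    using ex_convex_nhds[OF open_interior assms] by blast
  have "convex C" using C by (simp add: convex_def)
  moreover have "0 \<in> interior C" using W interior_maximal by blast
  ultimately show ?thesis using W(4) interior_subset by blast
qed

instance real_normed_vector \<subseteq> locally_convex_space
proof
  fix a :: real and x :: 'a and V :: "'a set"
  show "LIM z (nhds a \<times>\<^sub>F nhds x). fst z *\<^sub>R snd z :> nhds (a *\<^sub>R x)"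
    by (intro tendsto_scaleR filterlim_fst filterlim_snd)
  assume "open V" "0 \<in> V"
  then obtain e where "e > 0" "ball 0 e \<subseteq> V" using open_contains_ball by blast
  then show "\<exists>C W. (\<forall>x\<in>C. \<forall>y\<in>C. \<forall>u\<ge>0. \<forall>v\<ge>0. u + v = 1 \<longrightarrow> u *\<^sub>R x + v *\<^sub>R y \<in> C) \<and>
      open W \<and> 0 \<in> W \<and> W \<subseteq> C \<and> C \<subseteq> V"
    using convex_ball[of "0::'a" e] unfolding convex_def
    by (intro exI[of _ "ball 0 e"]) auto
qed

definition seminorm :: "('a::real_vector \<Rightarrow> real) \<Rightarrow> bool" where
  "seminorm p \<longleftrightarrow>
     (\<forall>x. 0 \<le> p x) \<and> (\<forall>a x. p (a *\<^sub>R x) = \<bar>a\<bar> * p x) \<and> (\<forall>x y. p (x + y) \<le> p x + p y)"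

definition continuous_seminorm :: "('a::{real_vector,topological_space} \<Rightarrow> real) \<Rightarrow> bool" where
  "continuous_seminorm p \<longleftrightarrow> seminorm p \<and> continuous_on UNIV p"

definition tvs_bounded :: "'a::{real_vector,topological_space} set \<Rightarrow> bool" where
  "tvs_bounded B \<longleftrightarrow> (\<forall>V. 0 \<in> interior V \<longrightarrow> (\<exists>n::nat. B \<subseteq> (\<lambda>x. real n *\<^sub>R x) ` V))"

definition zero_nhds_base :: "'a::{zero,topological_space} set set \<Rightarrow> bool" where
  "zero_nhds_base \<B> \<longleftrightarrow>
     (\<forall>V\<in>\<B>. 0 \<in> interior V) \<and> (\<forall>V. 0 \<in> interior V \<longrightarrow> (\<exists>W\<in>\<B>. W \<subseteq> V))"

section \<open>Nonstandard extensions\<close>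

text \<open>
  A type \<open>'v\<close> plays the role of the standard universe, a type \<open>'w\<close> that of its nonstandard
  extension. Every finitary relation on \<open>'v\<close>, represented as a set of lists, has an extension
  to \<open>'w\<close>. The transfer principle says that \<open>'w\<close> is an elementary extension of \<open>'v\<close> in the
  first-order language having a symbol for every finitary relation on \<open>'v\<close>.
  No particular construction (such as an ultrapower) is prescribed. The universe may contain
  further objects, for instance sets of elements of the spaces under consideration; bounded
  quantification over such sets is then covered by the transfer principle as well.
\<close>

datatype 'v form =
    Eq nat nat
  | Rel "'v list set" "nat list"
  | Neg "'v form"
  | Conj "'v form" "'v form"
  | All nat "'v form"

primrec holds :: "('v list set \<Rightarrow> 'm list set) \<Rightarrow> 'v form \<Rightarrow> (nat \<Rightarrow> 'm) \<Rightarrow> bool" where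
  "holds I (Eq i j) s \<longleftrightarrow> s i = s j"
| "holds I (Rel R is) s \<longleftrightarrow> map s is \<in> I R"
| "holds I (Neg \<phi>) s \<longleftrightarrow> \<not> holds I \<phi> s"
| "holds I (Conj \<phi> \<psi>) s \<longleftrightarrow> holds I \<phi> s \<and> holds I \<psi> s"
| "holds I (All i \<phi>) s \<longleftrightarrow> (\<forall>x. holds I \<phi> (s(i := x)))"

record ('v, 'w) extension =
  rel_ext :: "'v list set \<Rightarrow> 'w list set"
  elem_ext :: "'v \<Rightarrow> 'w"

definition nonstandard_extension :: "('v, 'w) extension \<Rightarrow> bool" where
  "nonstandard_extension N \<longleftrightarrow>
     (\<forall>\<phi> s. holds (\<lambda>R. R) \<phi> s \<longleftrightarrow> holds (rel_ext N) \<phi> (elem_ext N \<circ> s))"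

text \<open>
  Internal sets are the sections, with arbitrary nonstandard parameters, of extended standard
  relations. If the universe contains the power set of a set \<open>X\<close>, then applying this to the
  membership relation gives the usual internal subsets of the extension of \<open>X\<close>.
\<close>

definition internal :: "('v, 'w) extension \<Rightarrow> 'w set \<Rightarrow> bool" where
  "internal N A \<longleftrightarrow> (\<exists>R ps. A = {x. x # ps \<in> rel_ext N R})"

definition saturated :: "'k rel \<Rightarrow> ('v, 'w) extension \<Rightarrow> bool" where
  "saturated \<kappa> N \<longleftrightarrow>
     (\<forall>\<A>. (\<forall>A\<in>\<A>. internal N A) \<and> |\<A>| <o \<kappa> \<and>
        (\<forall>\<F>. \<F> \<subseteq> \<A> \<and> finite \<F> \<longrightarrow> \<Inter>\<F> \<noteq> {}) \<longrightarrow> \<Inter>\<A> \<noteq> {})"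

text \<open>
  A type \<open>'a\<close> is part of the universe via an injection \<open>i :: 'a \<Rightarrow> 'v\<close>. The extension of a
  function depends only on its values on the given domain \<open>A\<close>; outside of the extension of \<open>A\<close>
  its value is unspecified.
\<close>

definition star_set :: "('v, 'w) extension \<Rightarrow> ('a \<Rightarrow> 'v) \<Rightarrow> 'a set \<Rightarrow> 'w set" where
  "star_set N i A = {x. [x] \<in> rel_ext N {[i a] | a. a \<in> A}}"

definition star_fun ::
  "('v, 'w) extension \<Rightarrow> ('a \<Rightarrow> 'v) \<Rightarrow> ('b \<Rightarrow> 'v) \<Rightarrow> 'a set \<Rightarrow> ('a \<Rightarrow> 'b) \<Rightarrow> 'w \<Rightarrow> 'w" where
  "star_fun N i j A f x = (THE y. [x, y] \<in> rel_ext N {[i a, j (f a)] | a. a \<in> A})"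

definition star_le :: "('v, 'w) extension \<Rightarrow> (real \<Rightarrow> 'v) \<Rightarrow> 'w \<Rightarrow> 'w \<Rightarrow> bool" where
  "star_le N r x y \<longleftrightarrow> [x, y] \<in> rel_ext N {[r a, r b] | a b. a \<le> b}"

definition finite_hyperreal :: "('v, 'w) extension \<Rightarrow> (real \<Rightarrow> 'v) \<Rightarrow> 'w \<Rightarrow> bool" where
  "finite_hyperreal N r x \<longleftrightarrow>
     x \<in> star_set N r UNIV \<and>
     (\<exists>n::nat. star_le N r (star_fun N r r UNIV abs x) (elem_ext N (r (real n))))"

definition fin_part ::
  "('v, 'w) extension \<Rightarrow> (real \<Rightarrow> 'v) \<Rightarrow> ('a::locally_convex_space \<Rightarrow> 'v) \<Rightarrow> 'w set" where
  "fin_part N r i =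
     {x \<in> star_set N i UNIV.
        \<forall>p. continuous_seminorm p \<longrightarrow> finite_hyperreal N r (star_fun N i r UNIV p x)}"

definition finite_function ::
  "('v, 'w) extension \<Rightarrow> (real \<Rightarrow> 'v) \<Rightarrow>
   ('a::locally_convex_space \<Rightarrow> 'v) \<Rightarrow> ('b::locally_convex_space \<Rightarrow> 'v) \<Rightarrow>
   'a set \<Rightarrow> ('a \<Rightarrow> 'b) \<Rightarrow> bool" where
  "finite_function N r i j U f \<longleftrightarrow>
     star_fun N i j U f ` (star_set N i U \<inter> fin_part N r i) \<subseteq> fin_part N r j"

end

theory Submission
  imports Defs
begin

text \<open>
  A continuous seminorm \<open>p\<close> takes finite values on the extension of \<open>f ` U\<close> because it is
  bounded on \<open>f ` U\<close> by one standard number \<open>n\<close>: the set \<open>f ` U\<close> is absorbed by the open unit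
  ball of \<open>p\<close>, and transfer carries the inequality \<open>p \<le> n\<close> from \<open>f ` U\<close> to its extension
  without changing \<open>n\<close>. So the extension of \<open>f ` U\<close>, into which the extension of \<open>f\<close> maps,
  lies in the finite part of \<open>F\<close>.

  The transfer argument is organised around one principle, \<open>star_fun_maps_into\<close>: an inclusion
  \<open>g ` A \<subseteq> B\<close> between standard sets passes to the extensions. It is applied in turn to \<open>f\<close>,
  to \<open>p\<close> and to the absolute value.
\<close>

abbreviation Implies :: "'v form \<Rightarrow> 'v form \<Rightarrow> 'v form" where
  "Implies \<phi> \<psi> \<equiv> Neg (Conj \<phi> (Neg \<psi>))"

abbreviation Exists :: "nat \<Rightarrow> 'v form \<Rightarrow> 'v form" where
  "Exists k \<phi> \<equiv> Neg (All k (Neg \<phi>))"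

lemma transfer_holds:
  assumes "nonstandard_extension N" and "holds (\<lambda>R. R) \<phi> s"
  shows "holds (rel_ext N) \<phi> (elem_ext N \<circ> s)"
  using assms unfolding nonstandard_extension_def by blast

lemma star_set_mono:
  assumes N: "nonstandard_extension N" and "A \<subseteq> B"
  shows "star_set N i A \<subseteq> star_set N i B"
proof -
  have "holds (\<lambda>R. R) (All 0 (Implies (Rel {[i a] | a. a \<in> A} [0]) (Rel {[i a] | a. a \<in> B} [0])))
          (\<lambda>_. undefined)"
    using \<open>A \<subseteq> B\<close> by auto
  from transfer_holds[OF N this] show ?thesis
    by (auto simp: star_set_def)
qed

text \<open>
  The definite description defining \<open>star_fun\<close> is justified by transferring totality and
  single-valuedness of the graph; the latter needs \<open>i\<close> to be injective, since otherwise the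
  graph on codes need not be the graph of a function.
\<close>

lemma star_fun_in_graph:
  assumes N: "nonstandard_extension N" and "inj i" and x: "x \<in> star_set N i D"
  shows "[x, star_fun N i j D g x] \<in> rel_ext N {[i a, j (g a)] | a. a \<in> D}"
    (is "_ \<in> rel_ext N ?G")
proof -
  have "holds (\<lambda>R. R) (All 0 (Implies (Rel {[i a] | a. a \<in> D} [0]) (Exists 1 (Rel ?G [0, 1]))))
          (\<lambda>_. undefined)"
    by auto
  from transfer_holds[OF N this] have "\<exists>y. [x, y] \<in> rel_ext N ?G"
    using x by (auto simp: star_set_def)
  moreover have "holds (\<lambda>R. R)
      (All 0 (All 1 (All 2 (Implies (Conj (Rel ?G [0, 1]) (Rel ?G [0, 2])) (Eq 1 2)))))
      (\<lambda>_. undefined)"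
    by (auto simp: inj_eq[OF \<open>inj i\<close>])
  from transfer_holds[OF N this]
  have "y = z" if "[x, y] \<in> rel_ext N ?G" "[x, z] \<in> rel_ext N ?G" for y z
    using that by auto
  ultimately have "\<exists>!y. [x, y] \<in> rel_ext N ?G" by blast
  then show ?thesis unfolding star_fun_def by (rule theI')
qed

text \<open>
  The set \<open>A\<close> may be smaller than the domain \<open>D\<close> on which the function is extended. This is
  what allows a bound that holds only on \<open>A\<close> to be used for a function extended from its
  whole domain.
\<close>

lemma star_fun_maps_into:
  assumes N: "nonstandard_extension N" and "inj i" and "A \<subseteq> D" and "g ` A \<subseteq> B"
    and x: "x \<in> star_set N i A"
  shows "star_fun N i j D g x \<in> star_set N j B"
proof -
  let ?G = "{[i a, j (g a)] | a. a \<in> D}"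
  have "x \<in> star_set N i D" using star_set_mono[OF N \<open>A \<subseteq> D\<close>] x by blast
  then have graph: "[x, star_fun N i j D g x] \<in> rel_ext N ?G"
    by (rule star_fun_in_graph[OF N \<open>inj i\<close>])
  have "holds (\<lambda>R. R)
      (All 0 (All 1 (Implies (Conj (Rel {[i a] | a. a \<in> A} [0]) (Rel ?G [0, 1]))
                         (Rel {[j b] | b. b \<in> B} [1]))))
      (\<lambda>_. undefined)"
    using \<open>g ` A \<subseteq> B\<close> by (auto simp: inj_eq[OF \<open>inj i\<close>])
  from transfer_holds[OF N this] show ?thesis
    using x graph by (auto simp: star_set_def)
qed

lemma star_le_if_in_star_atMost:
  assumes N: "nonstandard_extension N" and x: "x \<in> star_set N r {..c}"
  shows "star_le N r x (elem_ext N (r c))"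
proof -
  \<comment> \<open>The bound enters as a parameter: variable \<open>1\<close> stays free and is assigned the code of \<open>c\<close>.\<close>
  have "holds (\<lambda>R. R)
      (All 0 (Implies (Rel {[r a] | a. a \<in> {..c}} [0]) (Rel {[r a, r b] | a b. a \<le> b} [0, 1])))
      (\<lambda>_. r c)"
    by auto
  from transfer_holds[OF N this] show ?thesis
    using x by (auto simp: star_set_def star_le_def)
qed

lemma finite_hyperreal_if_in_star_interval:
  assumes N: "nonstandard_extension N" and "inj r"
    and x: "x \<in> star_set N r {- real n .. real n}"
  shows "finite_hyperreal N r x"
proof -
  have "x \<in> star_set N r UNIV" by (rule subsetD[OF star_set_mono[OF N subset_UNIV] x])
  moreover have "star_fun N r r UNIV abs x \<in> star_set N r {..real n}"
    by (rule star_fun_maps_into[OF N \<open>inj r\<close> _ _ x]) auto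
  ultimately show ?thesis
    unfolding finite_hyperreal_def using star_le_if_in_star_atMost[OF N] by blast
qed

lemma tvs_bounded_imp_seminorm_bounded:
  assumes "tvs_bounded B" and p: "continuous_seminorm p"
  obtains n :: nat where "\<And>b. b \<in> B \<Longrightarrow> p b \<le> real n"
proof -
  let ?V = "{x. p x < 1}"
  have scale: "p (a *\<^sub>R x) = \<bar>a\<bar> * p x" for a x
    using p by (simp add: continuous_seminorm_def seminorm_def)
  have "open ?V"
    using p by (intro open_Collect_less) (auto simp: continuous_seminorm_def)
  moreover have "p 0 = 0" using scale[of 0 0] by simp
  ultimately have "0 \<in> interior ?V" by (simp add: interior_open)
  then obtain n :: nat where n: "B \<subseteq> (\<lambda>x. real n *\<^sub>R x) ` ?V"
    using \<open>tvs_bounded B\<close> unfolding tvs_bounded_def by blast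
  have "p b \<le> real n" if b: "b \<in> B" for b
  proof -
    obtain v where "b = real n *\<^sub>R v" "p v < 1" using n b by blast
    then show ?thesis using mult_left_mono[of "p v" 1 "real n"] by (simp add: scale)
  qed
  then show ?thesis by (rule that)
qed

lemma star_set_bounded_subset_fin_part:
  assumes N: "nonstandard_extension N" and "inj r" and "inj i" and B: "tvs_bounded B"
  shows "star_set N i B \<subseteq> fin_part N r i"
proof
  fix y assume y: "y \<in> star_set N i B"
  have "finite_hyperreal N r (star_fun N i r UNIV p y)" if p: "continuous_seminorm p" for p
  proof -
    obtain n :: nat where n: "\<And>b. b \<in> B \<Longrightarrow> p b \<le> real n"
      using tvs_bounded_imp_seminorm_bounded[OF B p] by blast
    have nonneg: "0 \<le> p b" for b
      using p by (simp add: continuous_seminorm_def seminorm_def)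
    have "p ` B \<subseteq> {- real n .. real n}"
    proof
      fix t assume "t \<in> p ` B"
      then obtain b where "b \<in> B" "t = p b" by blast
      then show "t \<in> {- real n .. real n}" using n[of b] nonneg[of b] by simp
    qed
    then have "star_fun N i r UNIV p y \<in> star_set N r {- real n .. real n}"
      by (rule star_fun_maps_into[OF N \<open>inj i\<close> subset_UNIV _ y])
    then show ?thesis by (rule finite_hyperreal_if_in_star_interval[OF N \<open>inj r\<close>])
  qed
  moreover have "y \<in> star_set N i UNIV" by (rule subsetD[OF star_set_mono[OF N subset_UNIV] y])
  ultimately show "y \<in> fin_part N r i" by (simp add: fin_part_def)
qed

theorem lemma4p2:
  fixes N :: "('v, 'w) extension"
    and r :: "real \<Rightarrow> 'v"
    and i :: "'e::locally_convex_space \<Rightarrow> 'v"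
    and j :: "'f::locally_convex_space \<Rightarrow> 'v"
    and \<kappa> :: "'k rel"
    and \<B>E :: "'e set set" and \<B>F :: "'f set set"
    and U :: "'e set" and f :: "'e \<Rightarrow> 'f"
  assumes "nonstandard_extension N"
    and "inj r" and "inj i" and "inj j"
    and "Card_order \<kappa>" and "natLeq <o \<kappa>"
    and "zero_nhds_base \<B>E" and "|\<B>E| <o \<kappa>"
    and "zero_nhds_base \<B>F" and "|\<B>F| <o \<kappa>"
    and "saturated \<kappa> N"
    and "open U" and "0 \<in> U"
    and "tvs_bounded (f ` U)"
  shows "finite_function N r i j U f"
proof -
  have "star_fun N i j U f x \<in> fin_part N r j" if "x \<in> star_set N i U" for x
  proof -
    have "star_fun N i j U f x \<in> star_set N j (f ` U)"
      by (rule star_fun_maps_into[OF \<open>nonstandard_extension N\<close> \<open>inj i\<close> subset_refl subset_refl that])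
    then show ?thesis
      using star_set_bounded_subset_fin_part assms(1,2,4) \<open>tvs_bounded (f ` U)\<close> by blast
  qed
  then show ?thesis unfolding finite_function_def by blast
qed

end
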